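(* Let $G$ be a group and let $R$ be a $G$-graded ring such that every proper graded ideal of $R$ is a graded weakly prime ideal of $R$ and $R^2=R$. Then $GP(R)=GN(R)$ and $(GP(R))^2=(GN(R))^2=0$.
   Context: Rings are associative, not necessarily commutative and not necessarily with unity; ideals are two-sided. A ring $R$ is $G$-graded if $R=\bigoplus_{g\in G}R_g$ with additive subgroups $R_g$ satisfying $R_gR_h\subseteq R_{gh}$ for all $g,h\in G$. An ideal $I$ of $R$ is graded if $I=\bigoplus_{g\in G}(I\cap R_g)$. The product $IJ$ of ideals is the additive subgroup of all finite sums of products $xy$ with $x\in I$, $y\in J$, and $I^2=II$. A proper graded ideal $P$ of $R$ is graded prime if whenever $I,J$ are graded ideals of $R$ with $IJ\subseteq P$, then $I\subseteq P$ or $J\subseteq P$; it is graded weakly prime if whenever $I,J$ are graded ideals of $R$ with $0\neq IJ\subseteq P$, then $I\subseteq P$ or $J\subseteq P$. $GP(R)$ (the graded prime radical) denotes the intersection of all graded prime ideals of $R$ (an empty intersection being $R$), and $GN(R)$ denotes the sum of all graded ideals $I$ of $R$ with $I^2=0$. *)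

theory Defs
  imports Main
begin

text \<open>
  The ring \<open>R\<close> is a type of class \<^class>\<open>ring\<close>, which is associative, need not be
  commutative and need not have a unit; the zero ring is allowed.  The group \<open>G\<close> is a type
  of class \<^class>\<open>group_add\<close>, which is not assumed commutative: the group operation is
  written \<open>+\<close>, so that \<open>g + h\<close> stands for the product \<open>gh\<close>.
\<close>

definition add_subgroup :: "'r::ab_group_add set \<Rightarrow> bool" where
  "add_subgroup S \<longleftrightarrow>
     0 \<in> S \<and> (\<forall>x\<in>S. \<forall>y\<in>S. x + y \<in> S) \<and> (\<forall>x\<in>S. - x \<in> S)"

definition two_sided_ideal :: "'r::ring set \<Rightarrow> bool" where
  "two_sided_ideal I \<longleftrightarrow>
     add_subgroup I \<and> (\<forall>r. \<forall>x\<in>I. r * x \<in> I \<and> x * r \<in> I)"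

text \<open>The last conjunct is uniqueness of the decomposition, stated for \<open>0\<close>; this suffices
  because the \<open>M g\<close> are subgroups.\<close>

definition is_direct_sum :: "('g \<Rightarrow> 'r::ab_group_add set) \<Rightarrow> 'r set \<Rightarrow> bool" where
  "is_direct_sum M S \<longleftrightarrow>
     (\<forall>g. add_subgroup (M g)) \<and>
     S = {(\<Sum>g\<in>F. x g) | F x. finite F \<and> (\<forall>g\<in>F. x g \<in> M g)} \<and>
     (\<forall>F x. finite F \<longrightarrow> (\<forall>g\<in>F. x g \<in> M g) \<longrightarrow> (\<Sum>g\<in>F. x g) = 0 \<longrightarrow> (\<forall>g\<in>F. x g = 0))"

definition graded_ring :: "('g::group_add \<Rightarrow> 'r::ring set) \<Rightarrow> bool" where
  "graded_ring A \<longleftrightarrow>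
     is_direct_sum A UNIV \<and>
     (\<forall>g h. \<forall>x\<in>A g. \<forall>y\<in>A h. x * y \<in> A (g + h))"

definition graded_ideal :: "('g::group_add \<Rightarrow> 'r::ring set) \<Rightarrow> 'r set \<Rightarrow> bool" where
  "graded_ideal A I \<longleftrightarrow> two_sided_ideal I \<and> is_direct_sum (\<lambda>g. I \<inter> A g) I"

definition ideal_prod :: "'r::ring set \<Rightarrow> 'r set \<Rightarrow> 'r set" where
  "ideal_prod I J =
     {(\<Sum>i<n. x i * y i) | (n::nat) x y. \<forall>i<n. x i \<in> I \<and> y i \<in> J}"

text \<open>The sum of a family of ideals; for the empty family this is \<open>{0}\<close>.\<close>

definition ideal_sum :: "'r::ring set set \<Rightarrow> 'r set" where
  "ideal_sum \<I> = {(\<Sum>i<n. x i) | (n::nat) x. \<forall>i<n. x i \<in> \<Union>\<I>}"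

definition graded_prime :: "('g::group_add \<Rightarrow> 'r::ring set) \<Rightarrow> 'r set \<Rightarrow> bool" where
  "graded_prime A P \<longleftrightarrow>
     graded_ideal A P \<and> P \<noteq> UNIV \<and>
     (\<forall>I J. graded_ideal A I \<longrightarrow> graded_ideal A J \<longrightarrow>
        ideal_prod I J \<subseteq> P \<longrightarrow> I \<subseteq> P \<or> J \<subseteq> P)"

definition graded_weakly_prime :: "('g::group_add \<Rightarrow> 'r::ring set) \<Rightarrow> 'r set \<Rightarrow> bool" where
  "graded_weakly_prime A P \<longleftrightarrow>
     graded_ideal A P \<and> P \<noteq> UNIV \<and>
     (\<forall>I J. graded_ideal A I \<longrightarrow> graded_ideal A J \<longrightarrow>
        ideal_prod I J \<noteq> {0} \<longrightarrow> ideal_prod I J \<subseteq> P \<longrightarrow> I \<subseteq> P \<or> J \<subseteq> P)"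

text \<open>\<open>\<Inter>{} = UNIV\<close>, so \<open>GP A\<close> is the whole ring if there are no graded prime ideals.\<close>

definition GP :: "('g::group_add \<Rightarrow> 'r::ring set) \<Rightarrow> 'r set" where
  "GP A = \<Inter>{P. graded_prime A P}"

definition GN :: "('g::group_add \<Rightarrow> 'r::ring set) \<Rightarrow> 'r set" where
  "GN A = ideal_sum {I. graded_ideal A I \<and> ideal_prod I I = {0}}"

end

theory Submission
  imports Defs
begin

text \<open>
  If a graded weakly prime ideal \<open>P\<close> is not graded prime, witnessed by \<open>I J = 0\<close> with
  \<open>I, J\<close> not contained in \<open>P\<close>, then \<open>(P + I)(P + J)\<close> lies in \<open>P\<close>, so it must vanish, and in
  particular \<open>P\<^sup>2 = 0\<close>. Hence here every proper graded ideal is graded prime or has square zero.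
  Two graded ideals \<open>I, J\<close> of square zero satisfy \<open>I J = 0\<close>, as otherwise \<open>I \<inter> J\<close> being weakly
  prime would make them comparable; so \<open>GN\<^sup>2 = 0\<close>. Clearly \<open>GN \<subseteq> GP\<close>. For the converse,
  if \<open>GN\<close> is not graded prime then \<open>I J = 0\<close> for some graded ideals \<open>I, J\<close> not contained in \<open>GN\<close>;
  these have nonzero squares, and they are proper because \<open>R J = 0\<close> would give \<open>J\<^sup>2 = 0\<close> and
  likewise for \<open>I\<close>, so they are graded prime, whence
  \<open>GP\<^sup>2 \<subseteq> I J = 0\<close> and \<open>GP \<subseteq> GN\<close>.
\<close>

section \<open>Additive subgroups, products and sums of ideals\<close>

lemma add_subgroup_0: "add_subgroup S \<Longrightarrow> 0 \<in> S"
  and add_subgroup_add: "add_subgroup S \<Longrightarrow> x \<in> S \<Longrightarrow> y \<in> S \<Longrightarrow> x + y \<in> S"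
  and add_subgroup_uminus: "add_subgroup S \<Longrightarrow> x \<in> S \<Longrightarrow> - x \<in> S"
  by (auto simp: add_subgroup_def)

lemma add_subgroup_diff: "add_subgroup S \<Longrightarrow> x \<in> S \<Longrightarrow> y \<in> S \<Longrightarrow> x - y \<in> S"
  using add_subgroup_add[of S x "- y"] add_subgroup_uminus[of S y] by simp

lemma add_subgroup_sum:
  "add_subgroup S \<Longrightarrow> (\<And>i. i \<in> F \<Longrightarrow> f i \<in> S) \<Longrightarrow> sum f F \<in> S"
  by (induction F rule: infinite_finite_induct) (auto simp: add_subgroup_0 add_subgroup_add)

lemma add_subgroup_zero: "add_subgroup {0}"
  by (simp add: add_subgroup_def)

lemma add_subgroup_Int: "add_subgroup S \<Longrightarrow> add_subgroup T \<Longrightarrow> add_subgroup (S \<inter> T)"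
  by (simp add: add_subgroup_def)

text \<open>The set is the preimage of a subgroup under the additive map
  \<open>y \<mapsto> x * y\<close>. This and the next lemma let \<open>ideal_sum_subset_iff\<close>
  be applied in each factor of a product.\<close>

lemma add_subgroup_left_mult:
  assumes "add_subgroup S"
  shows "add_subgroup {y. (x::'r::ring) * y \<in> S}"
  using assms by (auto simp: add_subgroup_def distrib_left)

lemma add_subgroup_right_mult:
  assumes "add_subgroup S"
  shows "add_subgroup {x. \<forall>y\<in>T. (x::'r::ring) * y \<in> S}"
  using assms by (auto simp: add_subgroup_def distrib_right)

lemma ideal_add_subgroup: "two_sided_ideal I \<Longrightarrow> add_subgroup I"
  by (simp add: two_sided_ideal_def)

lemma ideal_prod_subset_iff:
  assumes "add_subgroup S"
  shows "ideal_prod I J \<subseteq> S \<longleftrightarrow> (\<forall>x\<in>I. \<forall>y\<in>J. x * y \<in> S)"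
proof
  assume sub: "ideal_prod I J \<subseteq> S"
  show "\<forall>x\<in>I. \<forall>y\<in>J. x * y \<in> S"
  proof (intro ballI)
    fix x y assume "x \<in> I" "y \<in> J"
    then have "(\<Sum>i<Suc 0. x * y) \<in> ideal_prod I J"
      unfolding ideal_prod_def
      by (intro CollectI exI[of _ "Suc 0"] exI[of _ "\<lambda>_. x"] exI[of _ "\<lambda>_. y"]) simp
    then show "x * y \<in> S" using sub by auto
  qed
qed (auto simp: ideal_prod_def intro!: add_subgroup_sum[OF assms])

lemma zero_in_ideal_prod: "0 \<in> ideal_prod I J"
  unfolding ideal_prod_def by (intro CollectI exI[of _ 0]) simp

lemma ideal_prod_eq_zero_iff: "ideal_prod I J = {0} \<longleftrightarrow> (\<forall>x\<in>I. \<forall>y\<in>J. x * y = 0)"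
  using ideal_prod_subset_iff[OF add_subgroup_zero, of I J] zero_in_ideal_prod[of I J] by auto

lemma ideal_prod_eq_zero_mono:
  "ideal_prod K L = {0} \<Longrightarrow> I \<subseteq> K \<Longrightarrow> J \<subseteq> L \<Longrightarrow> ideal_prod I J = {0}"
  unfolding ideal_prod_eq_zero_iff by blast

text \<open>Serves as an induction principle: a property that cuts out an additive subgroup holds on
  the whole sum once it holds on each summand.\<close>

lemma ideal_sum_subset_iff:
  assumes "add_subgroup S"
  shows "ideal_sum \<I> \<subseteq> S \<longleftrightarrow> (\<forall>I\<in>\<I>. I \<subseteq> S)"
proof
  assume sub: "ideal_sum \<I> \<subseteq> S"
  show "\<forall>I\<in>\<I>. I \<subseteq> S"
  proof (intro ballI subsetI)
    fix I x assume "I \<in> \<I>" "x \<in> I"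
    then have "(\<Sum>i<Suc 0. x) \<in> ideal_sum \<I>"
      unfolding ideal_sum_def
      by (intro CollectI exI[of _ "Suc 0"] exI[of _ "\<lambda>_. x"]) auto
    then show "x \<in> S" using sub by auto
  qed
next
  assume "\<forall>I\<in>\<I>. I \<subseteq> S"
  then have "\<Union>\<I> \<subseteq> S" by blast
  then show "ideal_sum \<I> \<subseteq> S"
    by (auto simp: ideal_sum_def intro!: add_subgroup_sum[OF assms])
qed

lemma add_subgroup_ideal_sum:
  assumes "\<And>I. I \<in> \<I> \<Longrightarrow> two_sided_ideal I"
  shows "add_subgroup (ideal_sum \<I>)"
  unfolding add_subgroup_def
proof (intro conjI ballI)
  show "0 \<in> ideal_sum \<I>"
    unfolding ideal_sum_def by (intro CollectI exI[of _ 0]) simp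
next
  fix x y assume "x \<in> ideal_sum \<I>" "y \<in> ideal_sum \<I>"
  then obtain m n :: nat and f g where
    x: "x = (\<Sum>i<m. f i)" "\<forall>i<m. f i \<in> \<Union>\<I>" and y: "y = (\<Sum>i<n. g i)" "\<forall>i<n. g i \<in> \<Union>\<I>"
    unfolding ideal_sum_def by blast
  \<comment> \<open>Concatenation of the two families. The induction below runs over the length
    \<open>k\<close> of the second one, with \<open>m\<close> fixed.\<close>
  let ?h = "\<lambda>i. if i < m then f i else g (i - m)"
  have "(\<Sum>i<m + k. ?h i) = (\<Sum>i<m. f i) + (\<Sum>i<k. g i)" for k
    by (induction k) (simp_all add: add.assoc)
  then have "x + y = (\<Sum>i<m + n. ?h i)"
    unfolding x y by simp
  moreover have "\<forall>i<m + n. ?h i \<in> \<Union>\<I>"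
    using x y by auto
  ultimately show "x + y \<in> ideal_sum \<I>"
    unfolding ideal_sum_def by blast
next
  fix x assume "x \<in> ideal_sum \<I>"
  then obtain n :: nat and f where x: "x = (\<Sum>i<n. f i)" "\<forall>i<n. f i \<in> \<Union>\<I>"
    unfolding ideal_sum_def by blast
  have "- x = (\<Sum>i<n. - f i)"
    by (simp add: x sum_negf)
  moreover have "\<forall>i<n. - f i \<in> \<Union>\<I>"
    using x(2) assms ideal_add_subgroup add_subgroup_uminus by blast
  ultimately show "- x \<in> ideal_sum \<I>"
    unfolding ideal_sum_def by blast
qed

lemma ideal_sum_upper:
  assumes "\<And>I. I \<in> \<I> \<Longrightarrow> two_sided_ideal I" "I \<in> \<I>"
  shows "I \<subseteq> ideal_sum \<I>"
  using ideal_sum_subset_iff[OF add_subgroup_ideal_sum[OF assms(1)]] assms(2) by blast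

lemma two_sided_ideal_ideal_sum:
  assumes "\<And>I. I \<in> \<I> \<Longrightarrow> two_sided_ideal I"
  shows "two_sided_ideal (ideal_sum \<I>)"
proof -
  let ?S = "ideal_sum \<I>"
  have sub: "add_subgroup ?S"
    using assms by (rule add_subgroup_ideal_sum)
  \<comment> \<open>The elements whose left and right multiples all stay in the sum form a subgroup
    containing every summand, hence the whole sum.\<close>
  have "add_subgroup {x. \<forall>r. r * x \<in> ?S \<and> x * r \<in> ?S}"
    using sub by (simp add: add_subgroup_def distrib_left distrib_right)
  moreover have "I \<subseteq> {x. \<forall>r. r * x \<in> ?S \<and> x * r \<in> ?S}" if "I \<in> \<I>" for I
    using ideal_sum_upper[OF assms that] assms[OF that] by (auto simp: two_sided_ideal_def)
  ultimately have "?S \<subseteq> {x. \<forall>r. r * x \<in> ?S \<and> x * r \<in> ?S}"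
    by (simp add: ideal_sum_subset_iff)
  then show ?thesis
    using sub by (auto simp: two_sided_ideal_def)
qed

text \<open>Biadditivity, one factor at a time: first extend in \<open>y\<close> for a fixed
  \<open>x\<close> from a single summand, then extend in \<open>x\<close>.\<close>

lemma ideal_prod_ideal_sum_subset:
  assumes S: "add_subgroup S"
    and "\<And>I J. I \<in> \<I> \<Longrightarrow> J \<in> \<J> \<Longrightarrow> ideal_prod I J \<subseteq> S"
  shows "ideal_prod (ideal_sum \<I>) (ideal_sum \<J>) \<subseteq> S"
proof -
  have prods: "x * y \<in> S" if "I \<in> \<I>" "J \<in> \<J>" "x \<in> I" "y \<in> J" for I J x y
    using assms(2)[OF that(1,2)] that(3,4) by (simp add: ideal_prod_subset_iff[OF S])
  have "I \<subseteq> {x. \<forall>y\<in>ideal_sum \<J>. x * y \<in> S}" if I: "I \<in> \<I>" for I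
  proof -
    have "ideal_sum \<J> \<subseteq> {y. x * y \<in> S}" if "x \<in> I" for x
      unfolding ideal_sum_subset_iff[OF add_subgroup_left_mult[OF S]]
      using prods[OF I] that by blast
    then show ?thesis by blast
  qed
  then have "ideal_sum \<I> \<subseteq> {x. \<forall>y\<in>ideal_sum \<J>. x * y \<in> S}"
    by (simp add: ideal_sum_subset_iff[OF add_subgroup_right_mult[OF S]])
  then show ?thesis
    by (auto simp: ideal_prod_subset_iff[OF S])
qed

section \<open>Homogeneous decompositions and graded ideals\<close>

definition homogeneous_sums :: "('g \<Rightarrow> 'r::ab_group_add set) \<Rightarrow> 'r set" where
  "homogeneous_sums M = {(\<Sum>g\<in>F. x g) | F x. finite F \<and> (\<forall>g\<in>F. x g \<in> M g)}"

lemma homogeneous_sumsI: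
  "finite F \<Longrightarrow> (\<And>g. g \<in> F \<Longrightarrow> x g \<in> M g) \<Longrightarrow> sum x F \<in> homogeneous_sums M"
  unfolding homogeneous_sums_def by blast

lemma homogeneous_sums_mono:
  "(\<And>g. M g \<subseteq> N g) \<Longrightarrow> homogeneous_sums M \<subseteq> homogeneous_sums N"
  unfolding homogeneous_sums_def by blast

text \<open>Extension by zero turns a decomposition into a family on the whole group with finite
  support, so that two of them can be compared or added over the union of their supports.\<close>

lemma homogeneous_sums_total:
  assumes "\<And>g. add_subgroup (M g)" "s \<in> homogeneous_sums M"
  shows "\<exists>F x. finite F \<and> (\<forall>g. x g \<in> M g) \<and> (\<forall>g. g \<notin> F \<longrightarrow> x g = 0) \<and> s = sum x F"
proof -
  obtain F x where x: "finite F" "\<forall>g\<in>F. x g \<in> M g" "s = sum x F"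
    using assms(2) unfolding homogeneous_sums_def by blast
  have "s = (\<Sum>g\<in>F. if g \<in> F then x g else 0)"
    unfolding x(3) by (rule sum.cong) auto
  then show ?thesis
    using x add_subgroup_0[OF assms(1)]
    by (intro exI[of _ F] exI[of _ "\<lambda>g. if g \<in> F then x g else 0"]) auto
qed

lemma add_subgroup_homogeneous_sums:
  assumes "\<And>g. add_subgroup (M g)"
  shows "add_subgroup (homogeneous_sums M)"
  unfolding add_subgroup_def
proof (intro conjI ballI)
  show "0 \<in> homogeneous_sums M"
    using homogeneous_sumsI[of "{}"] by simp
next
  fix s t assume s: "s \<in> homogeneous_sums M" and t: "t \<in> homogeneous_sums M"
  obtain F x where
    x: "finite F" "\<And>g. x g \<in> M g" "\<And>g. g \<notin> F \<Longrightarrow> x g = 0" "s = sum x F"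
    using homogeneous_sums_total[OF assms s] by blast
  obtain H y where
    y: "finite H" "\<And>g. y g \<in> M g" "\<And>g. g \<notin> H \<Longrightarrow> y g = 0" "t = sum y H"
    using homogeneous_sums_total[OF assms t] by blast
  have "s = sum x (F \<union> H)" "t = sum y (F \<union> H)"
    unfolding x(4) y(4) using x(1,3) y(1,3) by (auto intro!: sum.mono_neutral_left)
  then have "s + t = (\<Sum>g\<in>F \<union> H. x g + y g)"
    by (simp add: sum.distrib)
  then show "s + t \<in> homogeneous_sums M"
    using x y by (auto intro!: homogeneous_sumsI add_subgroup_add[OF assms])
next
  fix s assume s: "s \<in> homogeneous_sums M"
  obtain F x where x: "finite F" "\<And>g. x g \<in> M g" "s = sum x F"
    using homogeneous_sums_total[OF assms s] by blast
  have "- s = (\<Sum>g\<in>F. - x g)"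
    by (simp add: x sum_negf)
  then show "- s \<in> homogeneous_sums M"
    using x by (auto intro!: homogeneous_sumsI add_subgroup_uminus[OF assms])
qed

text \<open>Directness is stated for sums equal to 0, so it is applied to the difference
  \<open>x g - y g\<close> over \<open>F \<union> H\<close>.\<close>

lemma direct_sum_unique:
  assumes "is_direct_sum A S"
    and x: "finite F" "\<And>g. x g \<in> A g" "\<And>g. g \<notin> F \<Longrightarrow> x g = 0"
    and y: "finite H" "\<And>g. y g \<in> A g" "\<And>g. g \<notin> H \<Longrightarrow> y g = 0"
    and eq: "sum x F = sum y H"
  shows "x = y"
proof
  fix g
  have "sum x F = sum x (F \<union> H)" "sum y H = sum y (F \<union> H)"
    using x(1,3) y(1,3) by (auto intro!: sum.mono_neutral_left)
  then have "(\<Sum>g\<in>F \<union> H. x g - y g) = 0"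
    using eq by (simp add: sum_subtractf)
  moreover have "\<forall>g\<in>F \<union> H. x g - y g \<in> A g"
    using assms(1) x(2) y(2) by (auto simp: is_direct_sum_def intro: add_subgroup_diff)
  ultimately have "\<forall>g\<in>F \<union> H. x g - y g = 0"
    using assms(1) x(1) y(1) unfolding is_direct_sum_def by (meson finite_UnI)
  then show "x g = y g"
    using x(3) y(3) by (cases "g \<in> F \<union> H") auto
qed

text \<open>Independence of the components is inherited from \<open>A\<close>, and \<open>I\<close>
  is closed under sums. What remains to check is that each element of \<open>I\<close> splits into
  homogeneous parts lying in \<open>I\<close>.\<close>

lemma graded_ideal_iff:
  assumes "graded_ring A"
  shows "graded_ideal A I \<longleftrightarrow>
    two_sided_ideal I \<and> I \<subseteq> homogeneous_sums (\<lambda>g. I \<inter> A g)"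
proof
  assume "graded_ideal A I"
  then show "two_sided_ideal I \<and> I \<subseteq> homogeneous_sums (\<lambda>g. I \<inter> A g)"
    by (simp add: graded_ideal_def is_direct_sum_def homogeneous_sums_def)
next
  assume I: "two_sided_ideal I \<and> I \<subseteq> homogeneous_sums (\<lambda>g. I \<inter> A g)"
  then have sub: "add_subgroup I"
    by (simp add: two_sided_ideal_def)
  have A: "is_direct_sum A UNIV"
    using assms by (simp add: graded_ring_def)
  have "add_subgroup (I \<inter> A g)" for g
    using A sub by (simp add: is_direct_sum_def add_subgroup_Int)
  moreover have "homogeneous_sums (\<lambda>g. I \<inter> A g) \<subseteq> I"
    by (auto simp: homogeneous_sums_def intro: add_subgroup_sum[OF sub])
  then have "I = homogeneous_sums (\<lambda>g. I \<inter> A g)"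
    using I by blast
  moreover have "\<forall>F x. finite F \<longrightarrow> (\<forall>g\<in>F. x g \<in> I \<inter> A g) \<longrightarrow> sum x F = 0 \<longrightarrow> (\<forall>g\<in>F. x g = 0)"
    using A unfolding is_direct_sum_def by blast
  ultimately have "is_direct_sum (\<lambda>g. I \<inter> A g) I"
    unfolding is_direct_sum_def homogeneous_sums_def by blast
  then show "graded_ideal A I"
    using I by (simp add: graded_ideal_def)
qed

lemma graded_ideal_two_sided: "graded_ideal A I \<Longrightarrow> two_sided_ideal I"
  by (simp add: graded_ideal_def)

lemma graded_ideal_add_subgroup: "graded_ideal A I \<Longrightarrow> add_subgroup I"
  by (simp add: graded_ideal_def two_sided_ideal_def)

text \<open>The decomposition of an element in \<open>R\<close> is unique, so it agrees with the one
  inside each \<open>P\<close>; its components therefore lie in all \<open>P\<close> at once. The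
  empty family gives \<open>R\<close> itself, as \<open>GP\<close> requires.\<close>

lemma graded_ideal_Inter:
  assumes A: "graded_ring A" and \<P>: "\<And>P. P \<in> \<P> \<Longrightarrow> graded_ideal A P"
  shows "graded_ideal A (\<Inter>\<P>)"
proof -
  have ds: "is_direct_sum A UNIV"
    using A by (simp add: graded_ring_def)
  then have subA: "add_subgroup (A g)" for g
    by (simp add: is_direct_sum_def)
  have "two_sided_ideal (\<Inter>\<P>)"
    using graded_ideal_two_sided[OF \<P>] by (auto simp: two_sided_ideal_def add_subgroup_def)
  moreover have "s \<in> homogeneous_sums (\<lambda>g. \<Inter>\<P> \<inter> A g)" if s: "s \<in> \<Inter>\<P>" for s
  proof -
    have sA: "s \<in> homogeneous_sums A"
      using ds unfolding is_direct_sum_def homogeneous_sums_def by blast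
    obtain F x where
      x: "finite F" "\<And>g. x g \<in> A g" "\<And>g. g \<notin> F \<Longrightarrow> x g = 0" "s = sum x F"
      using homogeneous_sums_total[OF subA sA] by blast
    have "x g \<in> P" if P: "P \<in> \<P>" for P g
    proof -
      have sP: "s \<in> homogeneous_sums (\<lambda>g. P \<inter> A g)"
        using \<P>[OF P] s P by (auto simp: graded_ideal_iff[OF A])
      have subP: "add_subgroup (P \<inter> A g)" for g
        using graded_ideal_add_subgroup[OF \<P>[OF P]] subA by (rule add_subgroup_Int)
      obtain H y where
        y: "finite H" "\<And>g. y g \<in> P \<inter> A g" "\<And>g. g \<notin> H \<Longrightarrow> y g = 0" "s = sum y H"
        using homogeneous_sums_total[OF subP sP] by blast
      have "x = y"
        using y(2,4) x(4) by (intro direct_sum_unique[OF ds x(1-3) y(1) _ y(3)]) auto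
      then show ?thesis using y(2) by blast
    qed
    then show ?thesis
      using x by (auto intro!: homogeneous_sumsI)
  qed
  ultimately show ?thesis
    by (auto simp: graded_ideal_iff[OF A])
qed

lemma graded_ideal_Int:
  assumes "graded_ring A" "graded_ideal A I" "graded_ideal A J"
  shows "graded_ideal A (I \<inter> J)"
  using graded_ideal_Inter[OF assms(1), of "{I, J}"] assms(2,3) by auto

lemma graded_ideal_ideal_sum:
  assumes A: "graded_ring A" and \<I>: "\<And>I. I \<in> \<I> \<Longrightarrow> graded_ideal A I"
  shows "graded_ideal A (ideal_sum \<I>)"
proof -
  let ?S = "ideal_sum \<I>"
  have ideals: "\<And>I. I \<in> \<I> \<Longrightarrow> two_sided_ideal I"
    using \<I> by (rule graded_ideal_two_sided)
  have "add_subgroup (?S \<inter> A g)" for g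
    using A add_subgroup_ideal_sum[OF ideals]
    by (simp add: graded_ring_def is_direct_sum_def add_subgroup_Int)
  \<comment> \<open>The elements that split inside the sum form a subgroup; it contains each summand
    and hence the whole sum.\<close>
  then have "add_subgroup (homogeneous_sums (\<lambda>g. ?S \<inter> A g))"
    by (rule add_subgroup_homogeneous_sums)
  moreover have "I \<subseteq> homogeneous_sums (\<lambda>g. ?S \<inter> A g)" if I: "I \<in> \<I>" for I
  proof -
    have "I \<subseteq> homogeneous_sums (\<lambda>g. I \<inter> A g)"
      using \<I>[OF I] by (simp add: graded_ideal_iff[OF A])
    also have "\<dots> \<subseteq> homogeneous_sums (\<lambda>g. ?S \<inter> A g)"
      using ideal_sum_upper[OF ideals I] by (intro homogeneous_sums_mono) blast
    finally show ?thesis .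
  qed
  ultimately have "?S \<subseteq> homogeneous_sums (\<lambda>g. ?S \<inter> A g)"
    by (simp add: ideal_sum_subset_iff)
  then show ?thesis
    using two_sided_ideal_ideal_sum[OF ideals] by (simp add: graded_ideal_iff[OF A])
qed

section \<open>Graded weakly prime versus graded prime ideals\<close>

lemma graded_weakly_prime_not_prime:
  assumes P: "graded_weakly_prime A P" and "\<not> graded_prime A P"
  obtains I J where "graded_ideal A I" "graded_ideal A J" "ideal_prod I J = {0}"
    "\<not> I \<subseteq> P" "\<not> J \<subseteq> P"
proof -
  have "graded_ideal A P" "P \<noteq> UNIV"
    using P by (simp_all add: graded_weakly_prime_def)
  then obtain I J where IJ: "graded_ideal A I" "graded_ideal A J" "ideal_prod I J \<subseteq> P"
    "\<not> I \<subseteq> P" "\<not> J \<subseteq> P"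
    using assms(2) unfolding graded_prime_def by auto
  moreover from IJ P have "ideal_prod I J = {0}"
    unfolding graded_weakly_prime_def by auto
  ultimately show thesis
    using that by simp
qed

lemma graded_weakly_prime_prime_or_square_zero:
  assumes A: "graded_ring A" and P: "graded_weakly_prime A P"
  shows "graded_prime A P \<or> ideal_prod P P = {0}"
proof (rule disjCI, rule ccontr)
  assume nz: "ideal_prod P P \<noteq> {0}" and "\<not> graded_prime A P"
  then obtain I J where I: "graded_ideal A I" "\<not> I \<subseteq> P" and J: "graded_ideal A J" "\<not> J \<subseteq> P"
    and IJ: "ideal_prod I J = {0}"
    using graded_weakly_prime_not_prime[OF P] by metis
  have gP: "graded_ideal A P"
    using P by (simp add: graded_weakly_prime_def)
  let ?K = "ideal_sum {P, I}" and ?L = "ideal_sum {P, J}"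
  have KL: "graded_ideal A ?K" "graded_ideal A ?L"
    using gP I(1) J(1) by (auto intro!: graded_ideal_ideal_sum[OF A])
  have upper: "P \<subseteq> ?K" "I \<subseteq> ?K" "P \<subseteq> ?L" "J \<subseteq> ?L"
    by (rule ideal_sum_upper; use gP I(1) J(1) graded_ideal_two_sided in blast)+
  have sub: "add_subgroup P"
    using gP by (rule graded_ideal_add_subgroup)
  \<comment> \<open>Of the four products, those with a factor \<open>P\<close> lie in
    \<open>P\<close> because it is an ideal, and the remaining one is
    \<open>I J = 0\<close>.\<close>
  have "ideal_prod X Y \<subseteq> P" if "X \<in> {P, I}" "Y \<in> {P, J}" for X Y
    using that IJ graded_ideal_two_sided[OF gP] add_subgroup_0[OF sub]
    by (auto simp: ideal_prod_subset_iff[OF sub] ideal_prod_eq_zero_iff two_sided_ideal_def)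
  then have "ideal_prod ?K ?L \<subseteq> P"
    by (rule ideal_prod_ideal_sum_subset[OF sub])
  \<comment> \<open>Otherwise weak primeness puts \<open>?K\<close> or \<open>?L\<close> inside
    \<open>P\<close>, and with it \<open>I\<close> or \<open>J\<close>.\<close>
  then have "ideal_prod ?K ?L = {0}"
    using P KL upper I(2) J(2) unfolding graded_weakly_prime_def by (meson order_trans)
  then show False
    using upper nz ideal_prod_eq_zero_mono by blast
qed

section \<open>The radicals \<open>GP\<close> and \<open>GN\<close>\<close>

lemma graded_ideal_GP: "graded_ring A \<Longrightarrow> graded_ideal A (GP A)"
  unfolding GP_def by (rule graded_ideal_Inter) (auto simp: graded_prime_def)

lemma graded_ideal_GN: "graded_ring A \<Longrightarrow> graded_ideal A (GN A)"
  unfolding GN_def by (rule graded_ideal_ideal_sum) auto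

lemma square_zero_subset_GN: "graded_ideal A I \<Longrightarrow> ideal_prod I I = {0} \<Longrightarrow> I \<subseteq> GN A"
  unfolding GN_def by (rule ideal_sum_upper) (auto simp: graded_ideal_def)

text \<open>A graded prime \<open>P\<close> contains \<open>I I = 0\<close>, hence contains each
  square-zero graded ideal \<open>I\<close> and so their sum.\<close>

lemma GN_subset_GP: "GN A \<subseteq> GP A"
  unfolding GP_def
proof (rule Inter_greatest)
  fix P assume "P \<in> {P. graded_prime A P}"
  then have P: "graded_prime A P" by simp
  then have sub: "add_subgroup P"
    by (auto simp: graded_prime_def intro: graded_ideal_add_subgroup)
  have "I \<subseteq> P" if "graded_ideal A I" "ideal_prod I I = {0}" for I
    using P that add_subgroup_0[OF sub] unfolding graded_prime_def
    by (metis empty_subsetI insert_subset)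
  then show "GN A \<subseteq> P"
    by (simp add: GN_def ideal_sum_subset_iff[OF sub])
qed

lemma ideal_prod_GN_GN:
  fixes A :: "'g::group_add \<Rightarrow> 'r::ring set"
  assumes A: "graded_ring A"
    and wp: "\<And>P. graded_ideal A P \<Longrightarrow> P \<noteq> UNIV \<Longrightarrow> graded_weakly_prime A P"
  shows "ideal_prod (GN A) (GN A) = {0}"
proof -
  have "ideal_prod I J = {0}"
    if I: "graded_ideal A I" "ideal_prod I I = {0}" and J: "graded_ideal A J" "ideal_prod J J = {0}"
    for I J
  proof (rule ccontr)
    assume nz: "ideal_prod I J \<noteq> {0}"
    have gIJ: "graded_ideal A (I \<inter> J)"
      using A I(1) J(1) by (rule graded_ideal_Int)
    \<comment> \<open>If the intersection were \<open>R\<close>, then \<open>I = R\<close> and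
      \<open>I I = 0\<close> would make every product vanish, including \<open>I J\<close>.\<close>
    have "I \<inter> J \<noteq> UNIV"
      using nz I(2) by (auto simp: ideal_prod_eq_zero_iff)
    then have "graded_weakly_prime A (I \<inter> J)"
      using wp gIJ by blast
    moreover have "ideal_prod I J \<subseteq> I \<inter> J"
      using graded_ideal_two_sided[OF I(1)] graded_ideal_two_sided[OF J(1)]
      unfolding ideal_prod_subset_iff[OF graded_ideal_add_subgroup[OF gIJ]]
      by (simp add: two_sided_ideal_def)
    ultimately have "I \<subseteq> J \<or> J \<subseteq> I"
      using nz I(1) J(1) unfolding graded_weakly_prime_def by blast
    \<comment> \<open>Comparability places \<open>I J\<close> inside \<open>J J\<close> or
      \<open>I I\<close>, both zero.\<close>
    then show False
      using nz I(2) J(2) ideal_prod_eq_zero_mono by blast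
  qed
  then have "ideal_prod (GN A) (GN A) \<subseteq> {0}"
    unfolding GN_def by (intro ideal_prod_ideal_sum_subset add_subgroup_zero) auto
  then show ?thesis
    using zero_in_ideal_prod by blast
qed

theorem theorem2p13:
  fixes A :: "'g::group_add \<Rightarrow> 'r::ring set"
  assumes "graded_ring A"
    and "\<And>P. graded_ideal A P \<Longrightarrow> P \<noteq> UNIV \<Longrightarrow> graded_weakly_prime A P"
    and "ideal_prod (UNIV :: 'r set) UNIV = UNIV"
  shows "GP A = GN A \<and> ideal_prod (GP A) (GP A) = {0} \<and> ideal_prod (GN A) (GN A) = {0}"
proof -
  note A = assms(1) and wp = assms(2)
  have sq: "ideal_prod (GN A) (GN A) = {0}"
    using A wp by (rule ideal_prod_GN_GN)
  have prime: "graded_prime A I" if "graded_ideal A I" "I \<noteq> UNIV" "\<not> I \<subseteq> GN A" for I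
    using graded_weakly_prime_prime_or_square_zero[OF A wp[OF that(1,2)]]
      square_zero_subset_GN[OF that(1)] that(3) by blast
  have "GP A \<subseteq> GN A"
  proof (cases "GN A = UNIV \<or> graded_prime A (GN A)")
    \<comment> \<open>A graded prime \<open>GN A\<close> is itself one of the ideals intersected in
      \<open>GP A\<close>.\<close>
    case True
    then show ?thesis by (auto simp: GP_def)
  next
    case False
    then have "graded_weakly_prime A (GN A)"
      using wp graded_ideal_GN[OF A] by blast
    then obtain I J where I: "graded_ideal A I" "\<not> I \<subseteq> GN A"
      and J: "graded_ideal A J" "\<not> J \<subseteq> GN A" and IJ: "ideal_prod I J = {0}"
      using graded_weakly_prime_not_prime False by metis
    \<comment> \<open>If \<open>I = R\<close>, then \<open>J \<subseteq> I\<close> gives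
      \<open>J J = 0\<close> and so \<open>J \<subseteq> GN A\<close>. The argument for
      \<open>J\<close> is symmetric.\<close>
    have "I \<noteq> UNIV"
      using ideal_prod_eq_zero_mono[OF IJ] square_zero_subset_GN[OF J(1)] J(2) by blast
    moreover have "J \<noteq> UNIV"
      using ideal_prod_eq_zero_mono[OF IJ] square_zero_subset_GN[OF I(1)] I(2) by blast
    ultimately have "GP A \<subseteq> I" "GP A \<subseteq> J"
      using prime I J by (auto simp: GP_def)
    then have "ideal_prod (GP A) (GP A) = {0}"
      using IJ ideal_prod_eq_zero_mono by blast
    \<comment> \<open>\<open>GP A\<close> is now itself a graded ideal of square zero, so it is one
      of the summands of \<open>GN A\<close>.\<close>
    then show ?thesis
      using graded_ideal_GP[OF A] square_zero_subset_GN by blast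
  qed
  then have "GP A = GN A"
    using GN_subset_GP by blast
  then show ?thesis
    using sq by simp
qed

end
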